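(* Let $X$ be a real Hilbert space, let $T\colon X\to X$ be firmly nonexpansive, let $A\colon X\rightrightarrows X$ be maximally monotone, and suppose that $T=J_A$, or equivalently that $A=T^{-1}-\mathrm{Id}$. Then the following hold: (i) $\operatorname{ran}T=\operatorname{dom}A$. (ii) $T$ is surjective if and only if $\operatorname{dom}A=X$. (iii) $\mathrm{Id}-T$ is surjective if and only if $A$ is surjective (i.e., $\operatorname{ran}A=X$). (iv) $T$ is injective if and only if $A$ is at most single-valued. (v) $T$ is an isometry, i.e., $\|Tx-Ty\|=\|x-y\|$ for all $x,y\in X$, if and only if there exists $z\in X$ such that $A\colon x\mapsto z$ (that is, $Ax=\{z\}$ for every $x\in X$), in which case $T\colon x\mapsto x-z$. (vi) $T$ satisfies $$(\forall x\in X)(\forall y\in X)\quad Tx\neq Ty\;\Rightarrow\;\|Tx-Ty\|^2<\langle x-y,Tx-Ty\rangle$$ if and only if $A$ is strictly monotone, i.e., for all $(x,u),(y,v)\in\operatorname{gr}A$, $x\neq y\Rightarrow\langle x-y,u-v\rangle>0$. (vii) $T$ is strictly monotone if and only if $A$ is at most single-valued. (viii) $T$ is strictly firmly nonexpansive, i.e., for all $x,y\in X$, $x\neq y\Rightarrow\|Tx-Ty\|^2<\langle x-y,Tx-Ty\rangle$, if and only if $A$ is at most single-valued and strictly monotone. (ix) $T$ is strictly nonexpansive, i.e., for all $x,y\in X$, $x\neq y\Rightarrow\|Tx-Ty\|<\|x-y\|$, if and only if $A$ is disjointly injective, i.e., for all $x,y\in X$, $x\neq y\Rightarrow Ax\cap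 Ay=\varnothing$. (x) $T$ is injective and strictly nonexpansive, i.e., for all $x,y\in X$, $x\neq y\Rightarrow 0<\|Tx-Ty\|<\|x-y\|$, if and only if $A$ is at most single-valued and disjointly injective. (xi) Suppose that $\varepsilon\in\left]0,+\infty\right[$. Then $(1+\varepsilon)T$ is firmly nonexpansive if and only if $A$ is strongly monotone with constant $\varepsilon$, i.e., $A-\varepsilon\mathrm{Id}$ is monotone, in which case $T$ is a Banach contraction with constant $(1+\varepsilon)^{-1}$. (xii) Suppose that $\gamma\in\left]0,+\infty\right[$. Then $(1+\gamma)(\mathrm{Id}-T)$ is firmly nonexpansive if and only if $A$ is $\gamma$-cocoercive, i.e., for all $(x,u),(y,v)\in\operatorname{gr}A$, $\langle x-y,u-v\rangle\geq\gamma\|u-v\|^2$. (xiii) Suppose that $\beta\in\left]0,1\right[$. Then $T$ is a Banach contraction with constant $\beta$ if and only if, for all $(x,u),(y,v)\in\operatorname{gr}A$, $$\frac{1-\beta^2}{\beta^2}\|x-y\|^2\leq 2\langle x-y,u-v\rangle+\|u-v\|^2.$$ (xiv) Suppose that $\phi\colon[0,+\infty[\,\to[0,+\infty]$ is increasing and vanishes only at $0$. Then $T$ satisfies $$(\forall x\in X)(\forall y\in X)\quad\langle Tx-Ty,(x-Tx)-(y-Ty)\rangle\geq\phi\big(\|Tx-Ty\|\big)$$ if and only if $A$ is uniformly monotone with modulus $\phi$, i.e., for all $(x,u),(y,v)\in\operatorname{gr}A$, $\langle x-y,u-v\rangle\geq\phi(\|x-y\|)$. (xv) $T$ satisfies $$(\forall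 x\in X)(\forall y\in X)\quad\|Tx-Ty\|^2=\langle x-y,Tx-Ty\rangle\;\Rightarrow\;\begin{cases}Tx=T(Tx+y-Ty)\\ Ty=T(Ty+x-Tx)\end{cases}$$ if and only if $A$ is paramonotone, i.e., for all $(x,u),(y,v)\in\operatorname{gr}A$, $\langle x-y,u-v\rangle=0\Rightarrow\{(x,v),(y,u)\}\subseteq\operatorname{gr}A$. (xvi) $T$ is cyclically firmly nonexpansive, i.e., $$\sum_{i=1}^{n}\langle x_i-Tx_i,Tx_i-Tx_{i+1}\rangle\geq 0$$ for every set of points $\{x_1,\ldots,x_n\}\subseteq X$, where $n\in\{2,3,\ldots\}$ and $x_{n+1}=x_1$, if and only if $A$ is a subdifferential operator, i.e., there exists $f\in\Gamma_0$ such that $A=\partial f$. (xvii) $T$ satisfies $$(\forall x\in X)(\forall y\in X)\quad\inf_{z\in X}\langle Tx-Tz,(y-Ty)-(z-Tz)\rangle>-\infty$$ if and only if $A$ is rectangular (also known as $3^*$ monotone), i.e., $$(\forall x\in\operatorname{dom}A)(\forall v\in\operatorname{ran}A)\quad\inf_{(z,w)\in\operatorname{gr}A}\langle x-z,v-w\rangle>-\infty.$$ (xviii) $T$ is linear if and only if $A$ is a linear relation, i.e., $\operatorname{gr}A$ is a linear subspace of $X\times X$. (xix) $T$ is affine if and only if $A$ is an affine relation, i.e., $\operatorname{gr}A$ is an affine subspace of $X\times X$. (xx) $\operatorname{ran}T=\operatorname{Fix}T$ if and only if $A$ is a normal cone operator, i.e., $A=\partial\iota_C$ for some nonempty closed convex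 set $C\subseteq X$; equivalently, $T$ is a projection (nearest point) mapping $P_C$; here $C=\operatorname{ran}T=\operatorname{Fix}T$. (xxi) $T$ is sequentially weakly continuous if and only if $\operatorname{gr}A$ is sequentially weakly closed (in $X\times X$).
   Context: $X$ is a real Hilbert space with inner product $\langle\cdot,\cdot\rangle$ and norm $\|\cdot\|$; $\mathrm{Id}$ is the identity on $X$. A mapping $T\colon X\to X$ is firmly nonexpansive if $\|Tx-Ty\|^2+\|(\mathrm{Id}-T)x-(\mathrm{Id}-T)y\|^2\leq\|x-y\|^2$ for all $x,y\in X$. $T$ is a Banach contraction with constant $\beta\in[0,1[$ if it is Lipschitz continuous with constant $\beta$. $\operatorname{Fix}T=\{x\in X: x=Tx\}$. A set-valued operator $A\colon X\rightrightarrows X$ assigns to each $x\in X$ a subset $Ax\subseteq X$; $\operatorname{gr}A=\{(x,u):u\in Ax\}$, $\operatorname{dom}A=\{x:Ax\neq\varnothing\}$, $\operatorname{ran}A=\bigcup_{x\in X}Ax$, and $A^{-1}$ is defined by $x\in A^{-1}u\Leftrightarrow u\in Ax$. $A$ is at most single-valued if each $Ax$ contains at most one element. $A$ is monotone if $\langle x-y,u-v\rangle\geq0$ for all $(x,u),(y,v)\in\operatorname{gr}A$, and maximally monotone if no proper extension of $A$ (in the sense of graphs) is monotone. The resolvent of a maximally monotone $A$ is $J_A=(\mathrm{Id}+A)^{-1}$, which is a single-valued firmly nonexpansive mapping from $X$ to $X$ (Minty). $T^{-1}$ is the set-valued inverse of $T$. A single-valued map is identified with the corresponding set-valued operator. $\Gamma_0$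 is the set of functions $f\colon X\to\left]-\infty,+\infty\right]$ that are convex, lower semicontinuous and proper; $\partial f$ is the subdifferential in the sense of convex analysis; $\iota_C$ is the indicator function of $C$ ($0$ on $C$, $+\infty$ elsewhere); $P_C$ is the nearest point mapping onto $C$. *)

theory Defs
  imports "HOL-Analysis.Analysis"
begin

section \<open>Set-valued operators\<close>

text \<open>A set-valued operator is a function into the power set; a single-valued map \<open>T\<close> is
  identified with \<open>op_of T\<close>.  The algebraic operations are pointwise Minkowski operations
  (on the type of sets, \<open>-\<close> denotes set difference).\<close>

definition op_of :: "('a \<Rightarrow> 'b) \<Rightarrow> 'a \<Rightarrow> 'b set" where
  "op_of T = (\<lambda>x. {T x})"

definition gr :: "('a \<Rightarrow> 'b set) \<Rightarrow> ('a \<times> 'b) set" where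
  "gr A = {(x, u). u \<in> A x}"

definition op_dom :: "('a \<Rightarrow> 'b set) \<Rightarrow> 'a set" where
  "op_dom A = {x. A x \<noteq> {}}"

definition op_ran :: "('a \<Rightarrow> 'b set) \<Rightarrow> 'b set" where
  "op_ran A = (\<Union>x. A x)"

definition op_inv :: "('a \<Rightarrow> 'b set) \<Rightarrow> 'b \<Rightarrow> 'a set" where
  "op_inv A = (\<lambda>u. {x. u \<in> A x})"

definition op_plus :: "('a \<Rightarrow> 'b::ab_group_add set) \<Rightarrow> ('a \<Rightarrow> 'b set) \<Rightarrow> 'a \<Rightarrow> 'b set" where
  "op_plus A B = (\<lambda>x. {u + v | u v. u \<in> A x \<and> v \<in> B x})"

definition op_minus :: "('a \<Rightarrow> 'b::ab_group_add set) \<Rightarrow> ('a \<Rightarrow> 'b set) \<Rightarrow> 'a \<Rightarrow> 'b set" where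
  "op_minus A B = (\<lambda>x. {u - v | u v. u \<in> A x \<and> v \<in> B x})"

definition resolvent :: "('a::ab_group_add \<Rightarrow> 'a set) \<Rightarrow> 'a \<Rightarrow> 'a set" where
  "resolvent A = op_inv (op_plus (op_of id) A)"

definition at_most_single_valued :: "('a \<Rightarrow> 'b set) \<Rightarrow> bool" where
  "at_most_single_valued A \<longleftrightarrow> (\<forall>x. \<forall>u\<in>A x. \<forall>v\<in>A x. u = v)"

definition disjointly_injective :: "('a \<Rightarrow> 'b set) \<Rightarrow> bool" where
  "disjointly_injective A \<longleftrightarrow> (\<forall>x y. x \<noteq> y \<longrightarrow> A x \<inter> A y = {})"

section \<open>Monotonicity notions\<close>

definition monotone_op :: "('a::real_inner \<Rightarrow> 'a set) \<Rightarrow> bool" where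
  "monotone_op A \<longleftrightarrow> (\<forall>(x, u)\<in>gr A. \<forall>(y, v)\<in>gr A. inner (x - y) (u - v) \<ge> 0)"

definition maximally_monotone :: "('a::real_inner \<Rightarrow> 'a set) \<Rightarrow> bool" where
  "maximally_monotone A \<longleftrightarrow> monotone_op A \<and> \<not> (\<exists>B. monotone_op B \<and> gr A \<subset> gr B)"

definition strictly_monotone :: "('a::real_inner \<Rightarrow> 'a set) \<Rightarrow> bool" where
  "strictly_monotone A \<longleftrightarrow>
     (\<forall>(x, u)\<in>gr A. \<forall>(y, v)\<in>gr A. x \<noteq> y \<longrightarrow> inner (x - y) (u - v) > 0)"

definition strongly_monotone :: "real \<Rightarrow> ('a::real_inner \<Rightarrow> 'a set) \<Rightarrow> bool" where
  "strongly_monotone \<epsilon> A \<longleftrightarrow> monotone_op (op_minus A (op_of (\<lambda>x. \<epsilon> *\<^sub>R x)))"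

definition cocoercive :: "real \<Rightarrow> ('a::real_inner \<Rightarrow> 'a set) \<Rightarrow> bool" where
  "cocoercive \<gamma> A \<longleftrightarrow>
     (\<forall>(x, u)\<in>gr A. \<forall>(y, v)\<in>gr A. inner (x - y) (u - v) \<ge> \<gamma> * (norm (u - v))\<^sup>2)"

text \<open>A modulus \<open>\<phi>\<close> maps \<open>[0, \<infinity>[\<close> to \<open>[0, \<infinity>]\<close>; its values at negative reals are irrelevant.\<close>

definition uniformly_monotone :: "(real \<Rightarrow> ennreal) \<Rightarrow> ('a::real_inner \<Rightarrow> 'a set) \<Rightarrow> bool" where
  "uniformly_monotone \<phi> A \<longleftrightarrow>
     (\<forall>(x, u)\<in>gr A. \<forall>(y, v)\<in>gr A.
        ereal (inner (x - y) (u - v)) \<ge> enn2ereal (\<phi> (norm (x - y))))"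

definition paramonotone :: "('a::real_inner \<Rightarrow> 'a set) \<Rightarrow> bool" where
  "paramonotone A \<longleftrightarrow>
     (\<forall>(x, u)\<in>gr A. \<forall>(y, v)\<in>gr A. inner (x - y) (u - v) = 0 \<longrightarrow> {(x, v), (y, u)} \<subseteq> gr A)"

definition rectangular :: "('a::real_inner \<Rightarrow> 'a set) \<Rightarrow> bool" where
  "rectangular A \<longleftrightarrow>
     (\<forall>x\<in>op_dom A. \<forall>v\<in>op_ran A. (INF (z, w)\<in>gr A. ereal (inner (x - z) (v - w))) > -\<infinity>)"

section \<open>Nonexpansiveness notions\<close>

definition firmly_nonexpansive :: "('a::real_inner \<Rightarrow> 'a) \<Rightarrow> bool" where
  "firmly_nonexpansive T \<longleftrightarrow>
     (\<forall>x y. (norm (T x - T y))\<^sup>2 + (norm ((x - T x) - (y - T y)))\<^sup>2 \<le> (norm (x - y))\<^sup>2)"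

definition strictly_firmly_nonexpansive :: "('a::real_inner \<Rightarrow> 'a) \<Rightarrow> bool" where
  "strictly_firmly_nonexpansive T \<longleftrightarrow>
     (\<forall>x y. x \<noteq> y \<longrightarrow> (norm (T x - T y))\<^sup>2 < inner (x - y) (T x - T y))"

definition strictly_nonexpansive :: "('a::real_normed_vector \<Rightarrow> 'a) \<Rightarrow> bool" where
  "strictly_nonexpansive T \<longleftrightarrow> (\<forall>x y. x \<noteq> y \<longrightarrow> norm (T x - T y) < norm (x - y))"

definition cyclically_firmly_nonexpansive :: "('a::real_inner \<Rightarrow> 'a) \<Rightarrow> bool" where
  "cyclically_firmly_nonexpansive T \<longleftrightarrow>
     (\<forall>n\<ge>2. \<forall>x :: nat \<Rightarrow> 'a. x (n + 1) = x 1 \<longrightarrow>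
        (\<Sum>i=1..n. inner (x i - T (x i)) (T (x i) - T (x (i + 1)))) \<ge> 0)"

definition banach_contraction :: "real \<Rightarrow> ('a::metric_space \<Rightarrow> 'a) \<Rightarrow> bool" where
  "banach_contraction \<beta> T \<longleftrightarrow> 0 \<le> \<beta> \<and> \<beta> < 1 \<and> \<beta>-lipschitz_on UNIV T"

definition Fix :: "('a \<Rightarrow> 'a) \<Rightarrow> 'a set" where
  "Fix T = {x. x = T x}"

definition affine_map :: "('a::real_vector \<Rightarrow> 'b::real_vector) \<Rightarrow> bool" where
  "affine_map T \<longleftrightarrow>
     (\<forall>x y. \<forall>t::real. T (t *\<^sub>R x + (1 - t) *\<^sub>R y) = t *\<^sub>R T x + (1 - t) *\<^sub>R T y)"

text \<open>The library predicate \<open>affine\<close> also holds of the empty set, which is not an affine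
  subspace.\<close>

definition affine_relation :: "('a::real_vector \<Rightarrow> 'a set) \<Rightarrow> bool" where
  "affine_relation A \<longleftrightarrow> gr A \<noteq> {} \<and> affine (gr A)"

section \<open>Convex analysis\<close>

text \<open>Since \<open>f\<close> never takes the value \<open>-\<infinity>\<close> and the weights are positive, the right-hand side of
  the convexity inequality involves no indeterminate form.\<close>

definition Gamma0 :: "('a::real_normed_vector \<Rightarrow> ereal) set" where
  "Gamma0 = {f. (\<forall>x. f x \<noteq> -\<infinity>) \<and> (\<exists>x. f x \<noteq> \<infinity>) \<and>
     (\<forall>x y. \<forall>t::real. 0 < t \<and> t < 1 \<longrightarrow>
        f (t *\<^sub>R x + (1 - t) *\<^sub>R y) \<le> ereal t * f x + ereal (1 - t) * f y) \<and>
     (\<forall>x. f x \<le> Liminf (at x) f)}"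

definition subdifferential :: "('a::real_inner \<Rightarrow> ereal) \<Rightarrow> 'a \<Rightarrow> 'a set" where
  "subdifferential f = (\<lambda>x. {u. \<forall>y. ereal (inner (y - x) u) + f x \<le> f y})"

definition iota :: "'a set \<Rightarrow> 'a \<Rightarrow> ereal" where
  "iota C = (\<lambda>x. if x \<in> C then 0 else \<infinity>)"

definition normal_cone_operator :: "('a::real_inner \<Rightarrow> 'a set) \<Rightarrow> bool" where
  "normal_cone_operator A \<longleftrightarrow>
     (\<exists>C. C \<noteq> {} \<and> closed C \<and> convex C \<and> A = subdifferential (iota C))"

text \<open>The library's \<open>closest_point\<close> is restricted to Heine-Borel (hence finite-dimensional)
  spaces; this is the same notion on any metric space.\<close>

definition nearest_point :: "'a::metric_space set \<Rightarrow> 'a \<Rightarrow> 'a" where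
  "nearest_point C x = (THE p. p \<in> C \<and> (\<forall>c\<in>C. dist x p \<le> dist x c))"

section \<open>Weak sequential notions\<close>

text \<open>On a Hilbert space the continuous linear functionals are exactly the maps
  \<open>\<lambda>x. inner x u\<close>; for pairs, \<open>inner\<close> is that of the product Hilbert space.\<close>

definition weakly_converges :: "(nat \<Rightarrow> 'a::real_inner) \<Rightarrow> 'a \<Rightarrow> bool" where
  "weakly_converges s x \<longleftrightarrow> (\<forall>u. (\<lambda>n. inner (s n) u) \<longlonglongrightarrow> inner x u)"

definition sequentially_weakly_continuous :: "('a::real_inner \<Rightarrow> 'b::real_inner) \<Rightarrow> bool" where
  "sequentially_weakly_continuous T \<longleftrightarrow>
     (\<forall>s x. weakly_converges s x \<longrightarrow> weakly_converges (\<lambda>n. T (s n)) (T x))"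

definition sequentially_weakly_closed :: "'a::real_inner set \<Rightarrow> bool" where
  "sequentially_weakly_closed S \<longleftrightarrow>
     (\<forall>s x. (\<forall>n. s n \<in> S) \<and> weakly_converges s x \<longrightarrow> x \<in> S)"

end

theory Submission
  imports Defs "HOL-Library.Diagonal_Subsequence"
begin

text \<open>Both \<open>T = J\<^sub>A\<close> and \<open>A = T\<^sup>-\<^sup>1 - Id\<close> say that \<open>u \<in> A p\<close> iff \<open>T (p + u) = p\<close>; hence \<open>gr A\<close> is
  parametrized by \<open>x \<mapsto> (T x, x - T x)\<close> (Minty), and a property of pairs of points of \<open>gr A\<close> is a
  property of pairs \<open>(x, y)\<close>. Most items are then identities between inner products. Three need more:
  for (xvi), Rockafellar's antiderivative \<open>f\<close> of a cyclically monotone \<open>A\<close> satisfies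
  \<open>gr A \<subseteq> gr (\<partial>f)\<close>, with equality by maximality; for (xx), maximality likewise turns
  \<open>gr A \<subseteq> gr (\<partial>\<iota>\<^sub>C)\<close> into equality, where \<open>C = Fix T\<close> is an intersection of half-spaces;
  for (xxi), \<open>T\<close> maps a weakly convergent sequence to a bounded one (uniform boundedness), and weak
  closedness of \<open>gr A\<close> identifies each of its weak subsequential limits.\<close>

section \<open>Weak sequential compactness in Hilbert spaces\<close>

text \<open>A minimizing sequence for the distance is Cauchy by the parallelogram identity, because
  midpoints stay in the convex set \<open>C\<close>; completeness supplies its limit.\<close>

lemma nearest_point_exists:
  fixes C :: "'a::{real_inner, complete_space} set"
  assumes "closed C" "convex C" "C \<noteq> {}"
  shows "\<exists>p\<in>C. \<forall>c\<in>C. dist x p \<le> dist x c"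
proof -
  define d where "d = infdist x C"
  have d_le: "d \<le> dist x c" if "c \<in> C" for c
    unfolding d_def using that by (rule infdist_le)
  have "d \<ge> 0" unfolding d_def by (rule infdist_nonneg)
  have "\<exists>c\<in>C. dist x c < d + inverse (real (Suc n))" for n
  proof (rule ccontr)
    assume "\<not> ?thesis"
    then have "d + inverse (real (Suc n)) \<le> infdist x C"
      using assms(3) by (simp add: infdist_notempty not_less cINF_greatest)
    then show False unfolding d_def by simp
  qed
  then obtain c where c: "\<And>n. c n \<in> C" "\<And>n. dist x (c n) < d + inverse (real (Suc n))"
    by metis
  \<comment> \<open>The excess of the squared distance over the squared infimum; it tends to 0 and
    controls the mutual distances.\<close>
  define a where "a n = (dist x (c n))\<^sup>2 - d\<^sup>2" for n
  have lim_d: "(\<lambda>n. dist x (c n)) \<longlonglongrightarrow> d"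
  proof (rule tendsto_sandwich[OF _ _ tendsto_const])
    show "(\<lambda>n. d + inverse (real (Suc n))) \<longlonglongrightarrow> d"
      using tendsto_add[OF tendsto_const LIMSEQ_inverse_real_of_nat, of d] by simp
    show "\<forall>\<^sub>F n in sequentially. dist x (c n) \<le> d + inverse (real (Suc n))"
      using c(2) by (simp add: less_imp_le)
  qed (use d_le c(1) in auto)
  have a0: "a \<longlonglongrightarrow> 0"
    unfolding a_def using tendsto_diff[OF tendsto_power[OF lim_d, of 2] tendsto_const[of "d\<^sup>2"]] by simp
  have bound: "(dist (c m) (c n))\<^sup>2 \<le> 2 * a m + 2 * a n" for m n
  proof -
    have "(1/2) *\<^sub>R c m + (1/2) *\<^sub>R c n \<in> C"
      using assms(2) c(1) by (intro convexD) auto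
    then have "d \<le> norm (x - ((1/2) *\<^sub>R c m + (1/2) *\<^sub>R c n))"
      using d_le by (simp add: dist_norm)
    then have "d\<^sup>2 \<le> (norm (x - ((1/2) *\<^sub>R c m + (1/2) *\<^sub>R c n)))\<^sup>2"
      using \<open>d \<ge> 0\<close> by (intro power_mono) auto
    then show ?thesis \<comment> \<open>parallelogram identity\<close>
      unfolding a_def dist_norm power2_norm_eq_inner
      by (simp add: inner_diff inner_add inner_commute field_simps)
  qed
  have "Cauchy c"
  proof (rule metric_CauchyI)
    fix e :: real assume "e > 0"
    then have "\<forall>\<^sub>F n in sequentially. a n < e\<^sup>2 / 4"
      using a0 by (intro order_tendstoD(2)) auto
    then obtain N where N: "\<And>n. n \<ge> N \<Longrightarrow> a n < e\<^sup>2 / 4"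
      by (auto simp: eventually_sequentially)
    show "\<exists>M. \<forall>m\<ge>M. \<forall>n\<ge>M. dist (c m) (c n) < e"
    proof (intro exI allI impI)
      fix m n assume "m \<ge> N" "n \<ge> N"
      then have "(dist (c m) (c n))\<^sup>2 < e\<^sup>2"
        using bound[of m n] N[of m] N[of n] by linarith
      then show "dist (c m) (c n) < e"
        using \<open>e > 0\<close> by (simp add: power2_less_imp_less)
    qed
  qed
  then obtain p where p: "c \<longlonglongrightarrow> p"
    using Cauchy_convergent convergent_def by blast
  have "p \<in> C"
    using closed_sequentially[OF assms(1)] c(1) p by blast
  moreover have "dist x p = d"
    using LIMSEQ_unique[OF tendsto_dist[OF tendsto_const p] lim_d] .
  ultimately show ?thesis using d_le by auto
qed

text \<open>Existence and uniqueness give the \<open>THE\<close> in \<open>nearest_point\<close> a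
  value. A solution of the variational inequality is that value: testing the two points against each
  other bounds their squared distance by 0.\<close>

lemma nearest_point_iff:
  fixes C :: "'a::{real_inner, complete_space} set"
  assumes "closed C" "convex C" "C \<noteq> {}"
  shows "nearest_point C x = p \<longleftrightarrow> p \<in> C \<and> (\<forall>c\<in>C. inner (c - p) (x - p) \<le> 0)"
proof -
  obtain q where q: "q \<in> C" "\<forall>c\<in>C. dist x q \<le> dist x c"
    using nearest_point_exists[OF assms] by blast
  have the: "nearest_point C x = q"
    unfolding nearest_point_def
    using q any_closest_point_unique[OF assms(2,1)] by (intro the_equality) auto
  have dot: "inner (c - q) (x - q) \<le> 0" if "c \<in> C" for c
    using any_closest_point_dot[OF assms(2,1) q(1) that q(2)] by (simp add: inner_commute)
  have "q = p" if p: "p \<in> C" "\<forall>c\<in>C. inner (c - p) (x - p) \<le> 0"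
  proof -
    have "inner (q - p) (q - p) = inner (q - p) (x - p) + inner (p - q) (x - q)"
      by (simp add: inner_diff inner_commute)
    also have "\<dots> \<le> 0" using p q(1) dot by (simp add: add_nonpos_nonpos)
    finally show ?thesis by (metis inner_gt_zero_iff not_less right_minus_eq)
  qed
  then show ?thesis using the q(1) dot by auto
qed

text \<open>On a subspace the variational inequality can be tested with both \<open>p + v\<close>
  and \<open>p - v\<close>, which forces equality.\<close>

lemma orthogonal_projection_exists:
  fixes V :: "'a::{real_inner, complete_space} set"
  assumes "closed V" "subspace V"
  obtains p where "p \<in> V" "\<And>v. v \<in> V \<Longrightarrow> inner v (x - p) = 0"
proof -
  have "convex V" "V \<noteq> {}"
    using assms(2) by (auto simp: subspace_imp_convex dest: subspace_0)
  then obtain p where p: "p \<in> V" "\<And>c. c \<in> V \<Longrightarrow> inner (c - p) (x - p) \<le> 0"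
    using nearest_point_iff[OF assms(1)] by blast
  show thesis
  proof
    fix v assume v: "v \<in> V"
    have "inner (p + v - p) (x - p) \<le> 0" "inner (p - v - p) (x - p) \<le> 0"
      using p(2)[OF subspace_add[OF assms(2) p(1) v]] p(2)[OF subspace_diff[OF assms(2) p(1) v]] .
    then show "inner v (x - p) = 0" by simp
  qed (fact p(1))
qed

text \<open>For nonzero \<open>L\<close> the kernel is a closed hyperplane, and a suitable multiple
  of a normal vector \<open>w\<close> represents \<open>L\<close>.\<close>

lemma riesz_representation:
  fixes L :: "'a::{real_inner, complete_space} \<Rightarrow> real"
  assumes "bounded_linear L"
  obtains x where "\<And>y. L y = inner x y"
proof (cases "\<forall>u. L u = 0")
  case True
  then show thesis using that[of 0] by simp
next
  case False
  interpret bounded_linear L by fact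
  obtain u where u: "L u \<noteq> 0" using False by blast
  have "closed {v. L v = 0}"
    using continuous_on[OF continuous_on_id] by (intro closed_Collect_eq) auto
  moreover have "subspace {v. L v = 0}"
    by (auto simp: subspace_def add scaleR)
  ultimately obtain p where p: "L p = 0" "\<And>v. L v = 0 \<Longrightarrow> inner v (u - p) = 0"
    using orthogonal_projection_exists[of "{v. L v = 0}" u] by auto
  define w where "w = u - p"
  have Lw: "L w \<noteq> 0" using u p(1) by (simp add: w_def diff)
  then have w: "inner w w \<noteq> 0" using zero by auto
  show thesis
  proof
    fix y
    \<comment> \<open>Subtracting this multiple of \<open>w\<close> moves \<open>y\<close> into the
      kernel of \<open>L\<close>, which is orthogonal to \<open>w\<close>.\<close>
    have "inner (y - (L y / L w) *\<^sub>R w) w = 0"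
      using p(2)[of "y - (L y / L w) *\<^sub>R w"] Lw by (simp add: diff scaleR w_def[symmetric])
    then show "L y = inner ((L w / inner w w) *\<^sub>R w) y"
      using Lw w by (simp add: inner_diff inner_commute field_simps)
  qed
qed

section \<open>Uniform boundedness and weak subsequential limits\<close>

text \<open>By Baire's theorem the functionals \<open>inner (s n)\<close> share a bound on some
  ball, and increments from its centre reach every direction.\<close>

lemma pointwise_bounded_imp_bounded:
  fixes s :: "nat \<Rightarrow> 'a::{real_inner, complete_space}"
  assumes "\<And>u. bounded (range (\<lambda>n. inner (s n) u))"
  shows "bounded (range s)"
proof -
  define F where "F m = {u. \<forall>n. \<bar>inner (s n) u\<bar> \<le> real m}" for m
  have closed: "closed (F m)" for m
  proof -
    have "continuous_on UNIV (\<lambda>u. \<bar>inner (s n) u\<bar>)" for n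
      by (rule continuous_on_rabs[OF continuous_on_inner[OF continuous_on_const continuous_on_id]])
    then show ?thesis
      unfolding F_def by (rule closed_Collect_all[OF closed_Collect_le[OF _ continuous_on_const]])
  qed
  have cover: "(\<Union>m. F m) = UNIV"
  proof -
    have "\<exists>m. u \<in> F m" for u
    proof -
      obtain B where B: "\<And>n. \<bar>inner (s n) u\<bar> \<le> B"
        using assms[of u] by (auto simp: bounded_iff)
      obtain m where "B \<le> real m" using real_arch_simple by blast
      then show ?thesis unfolding F_def using B order_trans by blast
    qed
    then show ?thesis by blast
  qed
  have "\<exists>m. interior (F m) \<noteq> {}"
  proof (rule ccontr)
    assume "\<not> ?thesis"
    \<comment> \<open>If every closed set \<open>F m\<close> had empty interior, so would their
      countable union, which is the whole space.\<close>
    then have "Met_TC.mtopology interior_of \<Union>(range F) = {}"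
      using closed complete_UNIV by (intro Met_TC.metric_Baire_category_alt) auto
    then show False using cover by simp
  qed
  then obtain m x e where e: "e > 0" "cball x e \<subseteq> F m"
    by (auto simp: mem_interior_cball)
  have "norm (s n) \<le> 2 * real m / e" for n
  proof (cases "s n = 0")
    case False
    \<comment> \<open>The point at distance \<open>e\<close> from the centre in the direction of
      \<open>s n\<close>, where \<open>inner (s n)\<close> has grown by
      \<open>e * norm (s n)\<close>.\<close>
    define y where "y = x + (e / norm (s n)) *\<^sub>R s n"
    have "x \<in> cball x e" "y \<in> cball x e"
      using e(1) False by (auto simp: y_def dist_norm)
    then have "x \<in> F m" "y \<in> F m" using e(2) by blast+
    then have "\<bar>inner (s n) x\<bar> \<le> real m" "\<bar>inner (s n) y\<bar> \<le> real m"
      unfolding F_def by auto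
    then have "inner (s n) (y - x) \<le> 2 * real m"
      unfolding inner_diff by linarith
    moreover have "inner (s n) (y - x) = e * norm (s n)"
      using False by (simp add: y_def dot_square_norm power2_eq_square)
    ultimately show ?thesis using e(1) by (simp add: field_simps)
  qed (use e(1) in auto)
  then show ?thesis by (auto simp: bounded_iff)
qed

lemma weakly_convergent_imp_bounded:
  fixes s :: "nat \<Rightarrow> 'a::{real_inner, complete_space}"
  assumes "weakly_converges s x"
  shows "bounded (range s)"
proof (rule pointwise_bounded_imp_bounded)
  fix u
  show "bounded (range (\<lambda>n. inner (s n) u))"
    using convergent_imp_bounded[OF assms[unfolded weakly_converges_def, rule_format, of u]] .
qed

text \<open>Diagonal extraction makes the inner products with every \<open>s k\<close> converge. The
  closed subspace \<open>V\<close> extends this to all vectors, and the Riesz representation turns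
  the limit functional into the weak limit.\<close>

lemma bounded_imp_weakly_convergent_subseq:
  fixes s :: "nat \<Rightarrow> 'a::{real_inner, complete_space}"
  assumes "bounded (range s)"
  obtains r x where "strict_mono r" "weakly_converges (s \<circ> r) x"
proof -
  obtain B where B: "\<And>n. norm (s n) \<le> B"
    using assms by (auto simp: bounded_iff)
  have "B \<ge> 0" by (rule order_trans[OF norm_ge_zero B])
  define P where "P k r \<longleftrightarrow> convergent (\<lambda>n. inner (s (r n)) (s k))" for k r
  interpret subseqs P
  proof
    fix k and r :: "nat \<Rightarrow> nat" assume "strict_mono r"
    have "norm (inner (s (r n)) (s k)) \<le> B * B" for n
      using Cauchy_Schwarz_ineq2[of "s (r n)" "s k"] mult_mono[OF B[of "r n"] B[of k] \<open>B \<ge> 0\<close>]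
      by simp
    then have "bounded (range (\<lambda>n. inner (s (r n)) (s k)))"
      unfolding bounded_iff by blast
    then obtain l r' where "strict_mono r'" "((\<lambda>n. inner (s (r n)) (s k)) \<circ> r') \<longlonglongrightarrow> l"
      using bounded_imp_convergent_subsequence by blast
    then show "\<exists>r'. strict_mono r' \<and> P k (r \<circ> r')"
      unfolding P_def convergent_def by (auto simp: o_def)
  qed
  define d where "d = diagseq"
  \<comment> \<open>The diagonal sequence is a subsequence of the one chosen for \<open>k\<close>
    only from index \<open>Suc k\<close> on, hence the shift; convergence ignores the initial
    segment.\<close>
  have "P k (d \<circ> (+) (Suc k))" for k
    unfolding d_def
  proof (rule diagseq_holds)
    fix r r' :: "nat \<Rightarrow> nat" and j assume "strict_mono r" "P j r'"
    then show "P j (r' \<circ> r)"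
      unfolding P_def using convergent_subseq_convergent by (fastforce simp: o_def)
  qed
  then have "convergent (\<lambda>n. inner (s (d (n + Suc k))) (s k))" for k
    by (simp add: P_def add.commute[of _ k])
  from convergent_ignore_initial_segment[THEN iffD1, OF this]
  have conv_s: "convergent (\<lambda>n. inner (s (d n)) (s k))" for k .
  define t where "t = s \<circ> d"
  have tB: "\<bar>inner (t n) u\<bar> \<le> B * norm u" for n u
    using Cauchy_Schwarz_ineq2[of "t n" u] mult_right_mono[OF B[of "d n"], of "norm u"]
    by (simp add: t_def)
  define V where "V = {u. convergent (\<lambda>n. inner (t n) u)}"
  have sub: "subspace V"
    by (auto simp: V_def subspace_def inner_add_right
        intro: convergent_add convergent_mult convergent_const)
  \<comment> \<open>\<open>V\<close> contains every \<open>t n\<close>, so only the component of \<open>u\<close> in \<open>V\<close> matters for \<open>inner (t n) u\<close>.\<close>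
  have "closed V"
    unfolding closed_sequential_limits
  proof (intro allI impI, elim conjE)
    fix w l assume w: "\<forall>n. w n \<in> V" "w \<longlonglongrightarrow> l"
    have "Cauchy (\<lambda>n. inner (t n) l)"
    proof (rule metric_CauchyI)
      fix e :: real assume "e > 0"
      \<comment> \<open>\<open>B\<close> may be 0, so \<open>B + 1\<close> keeps the divisor
        positive. Replacing \<open>l\<close> by \<open>w k\<close> then costs less than
        \<open>e / 3\<close> at each of two indices.\<close>
      then have "e / (3 * (B + 1)) > 0" using \<open>B \<ge> 0\<close> by auto
      then obtain k where k: "norm (l - w k) < e / (3 * (B + 1))"
        using w(2) by (metis LIMSEQ_D norm_minus_commute order_refl)
      have small: "\<bar>inner (t n) (l - w k)\<bar> < e / 3" for n
      proof -
        have "\<bar>inner (t n) (l - w k)\<bar> \<le> (B + 1) * norm (l - w k)"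
          using tB[of n "l - w k"] norm_ge_zero[of "l - w k"] unfolding ring_distribs by linarith
        also have "\<dots> < e / 3" using k \<open>B \<ge> 0\<close> by (simp add: field_simps)
        finally show ?thesis .
      qed
      have "Cauchy (\<lambda>n. inner (t n) (w k))"
        using w(1) by (simp add: V_def convergent_Cauchy)
      then obtain M where M: "\<And>m n. m \<ge> M \<Longrightarrow> n \<ge> M \<Longrightarrow>
          dist (inner (t m) (w k)) (inner (t n) (w k)) < e / 3"
        using \<open>e > 0\<close> by (metis metric_CauchyD divide_pos_pos zero_less_numeral)
      show "\<exists>M. \<forall>m\<ge>M. \<forall>n\<ge>M. dist (inner (t m) l) (inner (t n) l) < e"
      proof (intro exI allI impI)
        fix m n assume "m \<ge> M" "n \<ge> M"
        then show "dist (inner (t m) l) (inner (t n) l) < e"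
          using M[of m n] small[of m] small[of n]
          unfolding dist_real_def inner_diff by linarith
      qed
    qed
    then show "l \<in> V" by (simp add: V_def Cauchy_convergent)
  qed
  have "convergent (\<lambda>n. inner (t n) u)" for u
  proof -
    obtain p where p: "p \<in> V" "\<And>v. v \<in> V \<Longrightarrow> inner v (u - p) = 0"
      using orthogonal_projection_exists[OF \<open>closed V\<close> sub] by blast
    have "t n \<in> V" for n using conv_s by (simp add: V_def t_def)
    then have "inner (t n) u = inner (t n) p" for n
      using p(2) by (simp add: inner_diff)
    then show ?thesis using p(1) by (simp add: V_def)
  qed
  then obtain L where L: "\<And>u. (\<lambda>n. inner (t n) u) \<longlonglongrightarrow> L u"
    unfolding convergent_def by metis
  have "bounded_linear L"
  proof (rule bounded_linear_intro)
    show "L (u + v) = L u + L v" for u v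
      using LIMSEQ_unique[OF L[of "u + v"]] tendsto_add[OF L[of u] L[of v]]
      by (simp add: inner_add_right)
    show "L (c *\<^sub>R u) = c *\<^sub>R L u" for c u
      using LIMSEQ_unique[OF L[of "c *\<^sub>R u"]] tendsto_mult_left[OF L[of u], of c] by simp
    show "norm (L u) \<le> norm u * B" for u
      using LIMSEQ_le_const2[OF tendsto_rabs[OF L[of u]]] tB by (simp add: mult.commute)
  qed
  then obtain x where "\<And>u. L u = inner x u" using riesz_representation by blast
  then have "weakly_converges (s \<circ> d) x"
    using L by (simp add: weakly_converges_def t_def)
  then show thesis using that subseq_diagseq by (simp add: d_def)
qed

section \<open>Monotone operators and subdifferentials\<close>

lemma firmly_nonexpansive_iff:
  "firmly_nonexpansive T \<longleftrightarrow> (\<forall>x y. (norm (T x - T y))\<^sup>2 \<le> inner (x - y) (T x - T y))"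
proof -
  have "(norm (T x - T y))\<^sup>2 + (norm ((x - T x) - (y - T y)))\<^sup>2 \<le> (norm (x - y))\<^sup>2 \<longleftrightarrow>
      (norm (T x - T y))\<^sup>2 \<le> inner (x - y) (T x - T y)" for x y
    unfolding power2_norm_eq_inner by (auto simp: inner_diff inner_commute)
  then show ?thesis unfolding firmly_nonexpansive_def by simp
qed

lemma firmly_nonexpansive_scaleR_iff:
  assumes "c > 0"
  shows "firmly_nonexpansive (\<lambda>x. c *\<^sub>R S x) \<longleftrightarrow>
    (\<forall>x y. c * (norm (S x - S y))\<^sup>2 \<le> inner (x - y) (S x - S y))"
proof -
  have "(norm (c *\<^sub>R S x - c *\<^sub>R S y))\<^sup>2 \<le> inner (x - y) (c *\<^sub>R S x - c *\<^sub>R S y) \<longleftrightarrow>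
      c * (norm (S x - S y))\<^sup>2 \<le> inner (x - y) (S x - S y)" for x y
  proof -
    have "(norm (c *\<^sub>R S x - c *\<^sub>R S y))\<^sup>2 = c * (c * (norm (S x - S y))\<^sup>2)"
      by (simp add: scaleR_diff_right[symmetric] power_mult_distrib power2_eq_square)
    moreover have "inner (x - y) (c *\<^sub>R S x - c *\<^sub>R S y) = c * inner (x - y) (S x - S y)"
      by (simp add: scaleR_diff_right[symmetric])
    ultimately show ?thesis using assms by simp
  qed
  then show ?thesis by (simp add: firmly_nonexpansive_iff)
qed

section \<open>Maximality, subdifferentials and cyclic monotonicity\<close>

lemma maximally_monotone_eqI:
  assumes "maximally_monotone A" "monotone_op B" "\<And>x. A x \<subseteq> B x"
  shows "A = B"
proof -
  have "gr A \<subseteq> gr B" using assms(3) by (auto simp: gr_def)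
  then have "gr A = gr B" using assms(1,2) unfolding maximally_monotone_def by blast
  then show ?thesis by (auto simp: gr_def set_eq_iff fun_eq_iff)
qed

text \<open>A subgradient at a point where \<open>f\<close> is infinite would force \<open>f\<close>
  to be infinite everywhere.\<close>

lemma subdifferential_finite:
  assumes "\<forall>x. f x \<noteq> -\<infinity>" "\<exists>x. f x \<noteq> \<infinity>" "u \<in> subdifferential f x"
  obtains r where "f x = ereal r"
proof (cases "f x")
  case PInf
  then have "f y = \<infinity>" for y
    using assms(3) unfolding subdifferential_def mem_Collect_eq by (auto dest: spec[of _ y])
  then show thesis using assms(2) by blast
qed (use assms(1) that in auto)

lemma subdifferential_le:
  assumes "u \<in> subdifferential f x" "f x = ereal r" "f y = ereal s"
  shows "inner (y - x) u \<le> s - r"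
proof -
  have "ereal (inner (y - x) u) + f x \<le> f y"
    using assms(1) by (simp add: subdifferential_def)
  then show ?thesis using assms(2,3) by simp
qed

text \<open>Adding the two subgradient inequalities cancels the function values.\<close>

lemma monotone_subdifferential:
  assumes "\<forall>x. f x \<noteq> -\<infinity>" "\<exists>x. f x \<noteq> \<infinity>"
  shows "monotone_op (subdifferential f)"
  unfolding monotone_op_def
proof (intro ballI, clarsimp simp: gr_def)
  fix x u y v assume *: "u \<in> subdifferential f x" "v \<in> subdifferential f y"
  obtain r s where rs: "f x = ereal r" "f y = ereal s"
    using subdifferential_finite[OF assms *(1)] subdifferential_finite[OF assms *(2)] by metis
  have "inner (y - x) u \<le> s - r" "inner (x - y) v \<le> r - s"
    using subdifferential_le[OF *(1) rs] subdifferential_le[OF *(2) rs(2,1)] by auto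
  then show "0 \<le> inner (x - y) (u - v)"
    by (simp add: inner_diff)
qed

text \<open>A cycle of length \<open>n + 1\<close> is the initial part \<open>z 0, \<dots>, z n\<close> of a sequence, whose remaining
  values are irrelevant.\<close>

definition chain_sum :: "nat \<Rightarrow> (nat \<Rightarrow> 'a::real_inner \<times> 'a) \<Rightarrow> 'a \<Rightarrow> real" where
  "chain_sum n z x = (\<Sum>i<n. inner (fst (z (Suc i)) - fst (z i)) (snd (z i))) +
     inner (x - fst (z n)) (snd (z n))"

definition cyclically_monotone :: "('a::real_inner \<Rightarrow> 'a set) \<Rightarrow> bool" where
  "cyclically_monotone A \<longleftrightarrow> (\<forall>n z. range z \<subseteq> gr A \<longrightarrow> chain_sum n z (fst (z 0)) \<le> 0)"

text \<open>Each term is bounded by an increment of \<open>f\<close>, and the increments telescope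
  around the cycle.\<close>

lemma cyclically_monotone_subdifferential:
  assumes "\<forall>x. f x \<noteq> -\<infinity>" "\<exists>x. f x \<noteq> \<infinity>"
  shows "cyclically_monotone (subdifferential f)"
  unfolding cyclically_monotone_def
proof (intro allI impI)
  fix n and z :: "nat \<Rightarrow> 'a \<times> 'a" assume z: "range z \<subseteq> gr (subdifferential f)"
  have sub: "snd (z i) \<in> subdifferential f (fst (z i))" for i
    using range_subsetD[OF z, of i] by (simp add: gr_def case_prod_unfold)
  define g where "g i = real_of_ereal (f (fst (z i)))" for i
  have g: "f (fst (z i)) = ereal (g i)" for i
    using subdifferential_finite[OF assms sub[of i]] by (metis g_def real_of_ereal.simps(1))
  have le: "inner (fst (z j) - fst (z i)) (snd (z i)) \<le> g j - g i" for i j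
    by (rule subdifferential_le[OF sub g g])
  have "chain_sum n z (fst (z 0)) \<le> (\<Sum>i<n. g (Suc i) - g i) + (g 0 - g n)"
    unfolding chain_sum_def by (intro add_mono sum_mono le)
  also have "\<dots> = 0" by (simp add: sum_lessThan_telescope)
  finally show "chain_sum n z (fst (z 0)) \<le> 0" .
qed

lemma continuous_chain_sum: "isCont (chain_sum n z) x"
  unfolding chain_sum_def by (intro continuous_intros)

text \<open>Rockafellar's antiderivative: the supremum of the chain sums issuing from a fixed point
  of the graph.\<close>

lemma cyclically_monotone_imp_subdifferential:
  fixes A :: "'a::real_inner \<Rightarrow> 'a set"
  assumes max: "maximally_monotone A" and cyc: "cyclically_monotone A" and ne: "z0 \<in> gr A"
  shows "\<exists>f\<in>Gamma0. A = subdifferential f"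
proof -
  define Z where "Z = {(n :: nat, z). range z \<subseteq> gr A \<and> z (0::nat) = z0}"
  define f where "f x = (SUP (n, z)\<in>Z. ereal (chain_sum n z x))" for x
  have upper: "ereal (chain_sum n z x) \<le> f x" if "(n, z) \<in> Z" for n z x
    unfolding f_def using SUP_upper[OF that, of "\<lambda>(n, z). ereal (chain_sum n z x)"] by simp
  have least: "f x \<le> c" if "\<And>n z. (n, z) \<in> Z \<Longrightarrow> ereal (chain_sum n z x) \<le> c" for x c
    unfolding f_def using that by (auto intro!: SUP_least)
  \<comment> \<open>The chain of length zero gives an affine minorant of \<open>f\<close>, which
    excludes the value minus infinity.\<close>
  have Z0: "(0, \<lambda>_. z0) \<in> Z" using ne by (auto simp: Z_def)
  have not_minf: "f x \<noteq> -\<infinity>" for x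
    using upper[OF Z0, of x] by auto
  \<comment> \<open>Evaluating a chain sum at its starting point closes the cycle.\<close>
  have "f (fst z0) \<le> 0"
    using cyc by (intro least) (auto simp: Z_def cyclically_monotone_def)
  then have proper: "\<exists>x. f x \<noteq> \<infinity>" by (metis ereal_infty_less_eq2(1) PInfty_neq_ereal(2) zero_ereal_def)
  have convex: "f (t *\<^sub>R x + (1 - t) *\<^sub>R y) \<le> ereal t * f x + ereal (1 - t) * f y"
    if t: "0 < t" "t < 1" for x y t
  proof (rule least)
    fix n z assume nz: "(n, z) \<in> Z"
    have "chain_sum n z (t *\<^sub>R x + (1 - t) *\<^sub>R y) = t * chain_sum n z x + (1 - t) * chain_sum n z y"
      by (simp add: chain_sum_def inner_diff inner_add algebra_simps)
    then have "ereal (chain_sum n z (t *\<^sub>R x + (1 - t) *\<^sub>R y)) =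
        ereal t * ereal (chain_sum n z x) + ereal (1 - t) * ereal (chain_sum n z y)"
      by simp
    also have "\<dots> \<le> ereal t * f x + ereal (1 - t) * f y"
      using t by (intro add_mono ereal_mult_left_mono upper[OF nz]) auto
    finally show "ereal (chain_sum n z (t *\<^sub>R x + (1 - t) *\<^sub>R y)) \<le> \<dots>" .
  qed
  have lsc: "f x \<le> Liminf (at x) f" for x
  \<comment> \<open>In the zero space the punctured filter is trivial, whereas
    \<open>lim_imp_Liminf\<close> asks for a nontrivial one.\<close>
  proof (cases "at x = bot")
    case True
    then show ?thesis by simp
  next
    case False
    show ?thesis
    proof (rule least)
      fix n z assume nz: "(n, z) \<in> Z"
      have "((\<lambda>y. ereal (chain_sum n z y)) \<longlongrightarrow> ereal (chain_sum n z x)) (at x)"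
        using continuous_chain_sum[of x n z] by (simp add: isCont_def)
      then have "ereal (chain_sum n z x) = Liminf (at x) (\<lambda>y. ereal (chain_sum n z y))"
        by (rule lim_imp_Liminf[OF False, symmetric])
      also have "\<dots> \<le> Liminf (at x) f"
        by (intro Liminf_mono always_eventually allI upper[OF nz])
      finally show "ereal (chain_sum n z x) \<le> Liminf (at x) f" .
    qed
  qed
  have "f \<in> Gamma0"
    unfolding Gamma0_def using not_minf proper convex lsc by blast
  moreover have "A = subdifferential f"
  proof (rule maximally_monotone_eqI[OF max])
    show "monotone_op (subdifferential f)"
      using not_minf proper by (intro monotone_subdifferential) auto
    fix x
    show "A x \<subseteq> subdifferential f x"
    proof
      fix u assume u: "u \<in> A x"
      have "ereal (inner (y - x) u) + f x \<le> f y" for y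
      proof -
        have "f x \<le> f y - ereal (inner (y - x) u)"
        proof (rule least)
          fix n z assume nz: "(n, z) \<in> Z"
          \<comment> \<open>The chain prolonged by the pair \<open>(x, u)\<close>: its sum at
            \<open>y\<close> is the old sum at \<open>x\<close> plus \<open>inner (y - x) u\<close>,
            and its starting point is unchanged.\<close>
          define z' where "z' = z(Suc n := (x, u))"
          have "(Suc n, z') \<in> Z"
            using nz u by (auto simp: Z_def z'_def gr_def)
          then have "ereal (chain_sum (Suc n) z' y) \<le> f y" by (rule upper)
          moreover have "chain_sum (Suc n) z' y = chain_sum n z x + inner (y - x) u"
            by (simp add: chain_sum_def z'_def)
          ultimately show "ereal (chain_sum n z x) \<le> f y - ereal (inner (y - x) u)"
            by (simp add: ereal_le_minus)
        qed
        then show ?thesis by (simp add: ereal_le_minus add.commute)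
      qed
      then show "u \<in> subdifferential f x" by (simp add: subdifferential_def)
    qed
  qed
  ultimately show ?thesis by blast
qed

text \<open>As \<open>C\<close> is nonempty, a subgradient at \<open>p\<close> forces
  \<open>iota C p\<close> to be finite; then only test points in \<open>C\<close>, of value 0,
  impose a condition.\<close>

lemma subdifferential_iota:
  assumes "C \<noteq> {}"
  shows "u \<in> subdifferential (iota C) p \<longleftrightarrow> p \<in> C \<and> (\<forall>c\<in>C. inner (c - p) u \<le> 0)"
  using assms by (auto simp: subdifferential_def iota_def zero_ereal_def split: if_splits)

lemma monotone_subdifferential_iota:
  assumes "C \<noteq> {}"
  shows "monotone_op (subdifferential (iota C))"
  using assms by (intro monotone_subdifferential) (auto simp: iota_def)

section \<open>Elementary properties of weak convergence\<close>

lemma weakly_converges_Pair: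
  "weakly_converges s (x, u) \<longleftrightarrow>
     weakly_converges (\<lambda>n. fst (s n)) x \<and> weakly_converges (\<lambda>n. snd (s n)) u"
proof
  assume "weakly_converges s (x, u)"
  then have lim: "(\<lambda>n. inner (s n) w) \<longlonglongrightarrow> inner (x, u) w" for w
    unfolding weakly_converges_def by blast
  show "weakly_converges (\<lambda>n. fst (s n)) x \<and> weakly_converges (\<lambda>n. snd (s n)) u"
    unfolding weakly_converges_def
    using lim[of "(_, 0)"] lim[of "(0, _)"] by (simp add: inner_prod_def)
next
  assume "weakly_converges (\<lambda>n. fst (s n)) x \<and> weakly_converges (\<lambda>n. snd (s n)) u"
  then show "weakly_converges s (x, u)"
    by (auto simp: weakly_converges_def inner_prod_def intro!: tendsto_add)
qed

lemma weakly_converges_add: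
  assumes "weakly_converges s x" "weakly_converges t y"
  shows "weakly_converges (\<lambda>n. s n + t n) (x + y)"
  using assms by (auto simp: weakly_converges_def inner_add_left intro!: tendsto_add)

lemma weakly_converges_diff:
  assumes "weakly_converges s x" "weakly_converges t y"
  shows "weakly_converges (\<lambda>n. s n - t n) (x - y)"
  using assms by (auto simp: weakly_converges_def inner_diff_left intro!: tendsto_diff)

lemma weakly_converges_subseq:
  assumes "weakly_converges s x" "strict_mono r"
  shows "weakly_converges (s \<circ> r) x"
  using assms LIMSEQ_subseq_LIMSEQ unfolding weakly_converges_def by (fastforce simp: o_def)

lemma weakly_converges_unique:
  assumes "weakly_converges s x" "weakly_converges s y"
  shows "x = y"
proof -
  have "inner (x - y) (x - y) = 0"
    using assms LIMSEQ_unique unfolding weakly_converges_def inner_diff_left by (metis diff_self)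
  then show ?thesis by simp
qed

section \<open>Pointwise forms of the resolvent relation\<close>

lemma mem_resolvent: "p \<in> resolvent A x \<longleftrightarrow> x - p \<in> A p"
  by (force simp: resolvent_def op_inv_def op_plus_def op_of_def)

lemma op_of_eq_resolvent_iff:
  "op_of T = resolvent A \<longleftrightarrow> (\<forall>x p. x - p \<in> A p \<longleftrightarrow> T x = p)"
  unfolding fun_eq_iff set_eq_iff mem_resolvent op_of_def by (metis singleton_iff)

text \<open>The right-hand side is that of \<open>op_of_eq_resolvent_iff\<close>, so the two ways of
  linking \<open>T\<close> and \<open>A\<close> agree; the substitution is
  \<open>x = p + u\<close>.\<close>

lemma eq_inverse_minus_id_iff:
  fixes T :: "'a::ab_group_add \<Rightarrow> 'a"
  shows "A = op_minus (op_inv (op_of T)) (op_of id) \<longleftrightarrow> (\<forall>x p. x - p \<in> A p \<longleftrightarrow> T x = p)"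
proof -
  have mem: "u \<in> op_minus (op_inv (op_of T)) (op_of id) p \<longleftrightarrow> T (p + u) = p" for u p
    by (force simp: op_minus_def op_inv_def op_of_def algebra_simps)
  have "A = op_minus (op_inv (op_of T)) (op_of id) \<longleftrightarrow> (\<forall>p u. u \<in> A p \<longleftrightarrow> T (p + u) = p)"
    by (simp add: fun_eq_iff set_eq_iff mem)
  also have "\<dots> \<longleftrightarrow> (\<forall>x p. x - p \<in> A p \<longleftrightarrow> T x = p)"
    by (metis add_diff_cancel_left' diff_add_cancel)
  finally show ?thesis .
qed

section \<open>Resolvents\<close>

locale resolvent_pair =
  fixes T :: "'a::{real_inner, complete_space} \<Rightarrow> 'a" and A :: "'a \<Rightarrow> 'a set"
  assumes firm: "firmly_nonexpansive T"
    and maximal: "maximally_monotone A"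
    and resolvent: "op_of T = resolvent A"
begin

section \<open>The graph of \<open>A\<close> parametrized by \<open>T\<close>\<close>

lemma mem_iff: "u \<in> A p \<longleftrightarrow> T (p + u) = p"
  using resolvent[unfolded op_of_eq_resolvent_iff, rule_format, of "p + u" p] by simp

lemma resid_mem: "x - T x \<in> A (T x)"
  by (simp add: mem_iff)

lemma gr_eq: "gr A = range (\<lambda>x. (T x, x - T x))"
proof -
  have "(p, u) \<in> range (\<lambda>x. (T x, x - T x))" if "T (p + u) = p" for p u
    using that by (intro image_eqI[of _ _ "p + u"]) auto
  then show ?thesis by (auto simp: gr_def mem_iff)
qed

lemma ball_gr_gr:
  "(\<forall>(x, u)\<in>gr A. \<forall>(y, v)\<in>gr A. P x u y v) \<longleftrightarrow> (\<forall>x y. P (T x) (x - T x) (T y) (y - T y))"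
  unfolding gr_eq by simp

lemma firm_le: "(norm (T x - T y))\<^sup>2 \<le> inner (x - y) (T x - T y)"
  using firm unfolding firmly_nonexpansive_iff by blast

lemma firm_sum:
  "(norm (T x - T y))\<^sup>2 + (norm ((x - T x) - (y - T y)))\<^sup>2 \<le> (norm (x - y))\<^sup>2"
  using firm unfolding firmly_nonexpansive_def by blast

text \<open>The inner product in the monotonicity of \<open>A\<close>, taken along the
  parametrization, is the slack in \<open>firm_le\<close>.\<close>

lemma inner_resid:
  "inner (T x - T y) ((x - T x) - (y - T y)) = inner (x - y) (T x - T y) - (norm (T x - T y))\<^sup>2"
  unfolding power2_norm_eq_inner by (simp add: inner_diff inner_commute)

lemma nonexpansive: "norm (T x - T y) \<le> norm (x - y)"
proof (rule power2_le_imp_le)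
  show "(norm (T x - T y))\<^sup>2 \<le> (norm (x - y))\<^sup>2"
    using firm_sum[of x y] zero_le_power2[of "norm ((x - T x) - (y - T y))"] by linarith
qed simp

text \<open>Equality in the nonexpansive estimate leaves no room for the residual term of
  \<open>firm_sum\<close>.\<close>

lemma resid_eq_if_norm_eq:
  assumes "norm (T x - T y) = norm (x - y)"
  shows "x - T x = y - T y"
  using firm_sum[of x y] assms by simp

section \<open>Ranges, injectivity and strict inequalities\<close>

lemma range_eq_dom: "range T = op_dom A"
proof -
  have "p \<in> range T" if "u \<in> A p" for p u
    using that unfolding mem_iff by (metis rangeI)
  then show ?thesis using resid_mem by (auto simp: op_dom_def)
qed

lemma range_resid_eq_ran: "range (\<lambda>x. x - T x) = op_ran A"
proof -
  have "u \<in> range (\<lambda>x. x - T x)" if "u \<in> A p" for p u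
    using that unfolding mem_iff by (intro image_eqI[of _ _ "p + u"]) auto
  then show ?thesis using resid_mem by (auto simp: op_ran_def)
qed

text \<open>Values \<open>u\<close> and \<open>v\<close> of \<open>A\<close> at \<open>p\<close>
  correspond to the preimages \<open>p + u\<close> and \<open>p + v\<close> of \<open>p\<close>
  under \<open>T\<close>.\<close>

lemma inj_iff: "inj T \<longleftrightarrow> at_most_single_valued A"
proof
  assume "inj T"
  then have "u = v" if "u \<in> A p" "v \<in> A p" for p u v
    using that unfolding mem_iff by (metis add_left_cancel injD)
  then show "at_most_single_valued A"
    unfolding at_most_single_valued_def by blast
next
  assume "at_most_single_valued A"
  then show "inj T"
    using resid_mem unfolding at_most_single_valued_def inj_def by (metis diff_add_cancel)
qed

lemma eq_translation:
  assumes "\<forall>x. A x = {z}"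
  shows "T x = x - z"
  using resid_mem[of x] assms by (simp add: algebra_simps)

lemma isometry_iff:
  "(\<forall>x y. norm (T x - T y) = norm (x - y)) \<longleftrightarrow> (\<exists>z. \<forall>x. A x = {z})"
proof
  assume iso: "\<forall>x y. norm (T x - T y) = norm (x - y)"
  define z where "z = 0 - T 0"
  have "x - T x = z" for x
    using resid_eq_if_norm_eq[OF iso[rule_format, of x 0]] by (simp add: z_def)
  then have "T x = x - z" for x
    by (metis diff_diff_eq2 add_diff_cancel_left')
  then have "A x = {z}" for x
    by (auto simp: mem_iff)
  then show "\<exists>z. \<forall>x. A x = {z}" by blast
qed (auto simp: eq_translation)

lemma strictly_monotone_iff:
  "(\<forall>x y. T x \<noteq> T y \<longrightarrow> (norm (T x - T y))\<^sup>2 < inner (x - y) (T x - T y)) \<longleftrightarrow> strictly_monotone A"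
  unfolding strictly_monotone_def ball_gr_gr inner_resid by simp

text \<open>Both sides amount to injectivity of \<open>T\<close>, since \<open>firm_le\<close>
  bounds the inner product below by the squared distance of the images.\<close>

lemma strictly_monotone_op_of_iff: "strictly_monotone (op_of T) \<longleftrightarrow> at_most_single_valued A"
proof -
  have "strictly_monotone (op_of T) \<longleftrightarrow> (\<forall>x y. x \<noteq> y \<longrightarrow> 0 < inner (x - y) (T x - T y))"
    by (auto simp: strictly_monotone_def gr_def op_of_def)
  also have "\<dots> \<longleftrightarrow> inj T"
  proof
    assume *: "\<forall>x y. x \<noteq> y \<longrightarrow> 0 < inner (x - y) (T x - T y)"
    show "inj T"
      using * by (intro injI) (metis diff_self inner_zero_right less_irrefl)
  next
    assume "inj T"
    then have "0 < (norm (T x - T y))\<^sup>2" if "x \<noteq> y" for x y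
      using that by (simp add: inj_eq)
    then show "\<forall>x y. x \<noteq> y \<longrightarrow> 0 < inner (x - y) (T x - T y)"
      using firm_le less_le_trans by blast
  qed
  finally show ?thesis using inj_iff by simp
qed

text \<open>For distinct points with the same image the strict inequality would read 0 < 0, so it
  contains injectivity; given that, \<open>x \<noteq> y\<close> and \<open>T x \<noteq> T y\<close>
  are the same condition.\<close>

lemma strictly_firmly_nonexpansive_iff:
  "strictly_firmly_nonexpansive T \<longleftrightarrow> at_most_single_valued A \<and> strictly_monotone A"
proof -
  have "strictly_firmly_nonexpansive T \<longleftrightarrow>
      inj T \<and> (\<forall>x y. T x \<noteq> T y \<longrightarrow> (norm (T x - T y))\<^sup>2 < inner (x - y) (T x - T y))"
  proof
    assume *: "strictly_firmly_nonexpansive T"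
    then have "inj T"
      unfolding strictly_firmly_nonexpansive_def inj_def by force
    then show "inj T \<and> (\<forall>x y. T x \<noteq> T y \<longrightarrow> (norm (T x - T y))\<^sup>2 < inner (x - y) (T x - T y))"
      using * unfolding strictly_firmly_nonexpansive_def by metis
  qed (auto simp: strictly_firmly_nonexpansive_def inj_eq)
  then show ?thesis using inj_iff strictly_monotone_iff by simp
qed

text \<open>If \<open>u\<close> is a value of \<open>A\<close> at both \<open>p\<close> and
  \<open>q\<close>, then \<open>T\<close> carries \<open>p + u\<close> and \<open>q + u\<close> to
  \<open>p\<close> and \<open>q\<close> without changing their distance. Conversely, a preserved
  distance yields a common residual.\<close>

lemma strictly_nonexpansive_iff: "strictly_nonexpansive T \<longleftrightarrow> disjointly_injective A"
proof
  assume *: "strictly_nonexpansive T"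
  have "p = q" if "T (p + u) = p" "T (q + u) = q" for p q u
  proof (rule ccontr)
    assume "p \<noteq> q"
    then have "norm (T (p + u) - T (q + u)) < norm ((p + u) - (q + u))"
      using *[unfolded strictly_nonexpansive_def, rule_format, of "p + u" "q + u"] by simp
    then show False using that by simp
  qed
  then show "disjointly_injective A"
    by (auto simp: disjointly_injective_def mem_iff)
next
  assume *: "disjointly_injective A"
  show "strictly_nonexpansive T"
    unfolding strictly_nonexpansive_def
  proof (intro allI impI)
    fix x y :: 'a assume "x \<noteq> y"
    have "norm (T x - T y) \<noteq> norm (x - y)"
    proof
      assume eq: "norm (T x - T y) = norm (x - y)"
      then have "x - T x \<in> A (T x) \<inter> A (T y)"
        using resid_eq_if_norm_eq[OF eq] resid_mem[of x] resid_mem[of y] by simp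
      then have "T x = T y" using * unfolding disjointly_injective_def by blast
      then show False using eq \<open>x \<noteq> y\<close> by simp
    qed
    then show "norm (T x - T y) < norm (x - y)"
      using nonexpansive[of x y] by simp
  qed
qed

lemma inj_strictly_nonexpansive_iff:
  "inj T \<and> strictly_nonexpansive T \<longleftrightarrow>
     (\<forall>x y. x \<noteq> y \<longrightarrow> 0 < norm (T x - T y) \<and> norm (T x - T y) < norm (x - y))"
  by (auto simp: strictly_nonexpansive_def inj_def)

section \<open>Quantitative forms of monotonicity\<close>

text \<open>Subtracting the multiple of the identity shifts only the second coordinates of the
  graph, and raises the coefficient 1 of \<open>firm_le\<close> by \<epsilon>.\<close>

lemma strongly_monotone_iff:
  "strongly_monotone \<epsilon> A \<longleftrightarrow>
     (\<forall>x y. (1 + \<epsilon>) * (norm (T x - T y))\<^sup>2 \<le> inner (x - y) (T x - T y))"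
proof -
  have "gr (op_minus A (op_of (\<lambda>x. \<epsilon> *\<^sub>R x))) = (\<lambda>(x, u). (x, u - \<epsilon> *\<^sub>R x)) ` gr A"
    by (force simp: gr_def op_minus_def op_of_def)
  then have "strongly_monotone \<epsilon> A \<longleftrightarrow> (\<forall>(x, u)\<in>gr A. \<forall>(y, v)\<in>gr A.
      0 \<le> inner (x - y) ((u - \<epsilon> *\<^sub>R x) - (v - \<epsilon> *\<^sub>R y)))"
    by (simp add: strongly_monotone_def monotone_op_def case_prod_unfold)
  also have "\<dots> \<longleftrightarrow> (\<forall>x y. 0 \<le> inner (T x - T y)
      ((x - T x - \<epsilon> *\<^sub>R T x) - (y - T y - \<epsilon> *\<^sub>R T y)))"
    by (rule ball_gr_gr)
  also have "\<dots> \<longleftrightarrow> (\<forall>x y. (1 + \<epsilon>) * (norm (T x - T y))\<^sup>2 \<le> inner (x - y) (T x - T y))"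
    unfolding power2_norm_eq_inner by (simp add: inner_diff inner_commute algebra_simps)
  finally show ?thesis .
qed

lemma strongly_monotone_imp_contraction:
  assumes "\<epsilon> > 0" "strongly_monotone \<epsilon> A"
  shows "banach_contraction (inverse (1 + \<epsilon>)) T"
proof -
  have "norm (T x - T y) \<le> inverse (1 + \<epsilon>) * norm (x - y)" for x y
  proof (cases "T x = T y")
    case False
    have "(1 + \<epsilon>) * (norm (T x - T y))\<^sup>2 \<le> inner (x - y) (T x - T y)"
      using assms(2) by (simp add: strongly_monotone_iff)
    also have "\<dots> \<le> norm (x - y) * norm (T x - T y)" by (rule norm_cauchy_schwarz)
    finally have "(1 + \<epsilon>) * norm (T x - T y) \<le> norm (x - y)"
      using False by (simp add: power2_eq_square mult.assoc[symmetric])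
    then show ?thesis using assms(1) by (simp add: field_simps)
  qed (use assms(1) in simp)
  then show ?thesis
    using assms(1) by (auto simp: banach_contraction_def lipschitz_on_def dist_norm inverse_less_1_iff)
qed

text \<open>Splitting \<open>x - y\<close> into the differences of images and of residuals releases
  one squared residual norm, which accounts for the 1 in \<open>1 + \<gamma>\<close>.\<close>

lemma cocoercive_iff:
  assumes "\<gamma> > 0"
  shows "firmly_nonexpansive (\<lambda>x. (1 + \<gamma>) *\<^sub>R (x - T x)) \<longleftrightarrow> cocoercive \<gamma> A"
proof -
  have "(1 + \<gamma>) * (norm ((x - T x) - (y - T y)))\<^sup>2 \<le> inner (x - y) ((x - T x) - (y - T y)) \<longleftrightarrow>
      \<gamma> * (norm ((x - T x) - (y - T y)))\<^sup>2 \<le> inner (T x - T y) ((x - T x) - (y - T y))" for x y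
  proof -
    have "inner (x - y) ((x - T x) - (y - T y)) =
        inner (T x - T y) ((x - T x) - (y - T y)) + (norm ((x - T x) - (y - T y)))\<^sup>2"
    proof -
      have "x - y = (T x - T y) + ((x - T x) - (y - T y))" by simp
      then show ?thesis by (metis inner_add_left power2_norm_eq_inner)
    qed
    then show ?thesis
      unfolding distrib_right mult_1_left by (intro iffI) linarith+
  qed
  then show ?thesis
    using assms unfolding cocoercive_def ball_gr_gr
    by (subst firmly_nonexpansive_scaleR_iff) auto
qed

lemma contraction_iff:
  assumes "0 < \<beta>" "\<beta> < 1"
  shows "banach_contraction \<beta> T \<longleftrightarrow>
    (\<forall>(x, u)\<in>gr A. \<forall>(y, v)\<in>gr A.
       (1 - \<beta>\<^sup>2) / \<beta>\<^sup>2 * (norm (x - y))\<^sup>2 \<le> 2 * inner (x - y) (u - v) + (norm (u - v))\<^sup>2)"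
proof -
  have "norm (T x - T y) \<le> \<beta> * norm (x - y) \<longleftrightarrow>
      (1 - \<beta>\<^sup>2) / \<beta>\<^sup>2 * (norm (T x - T y))\<^sup>2 \<le>
        2 * inner (T x - T y) ((x - T x) - (y - T y)) + (norm ((x - T x) - (y - T y)))\<^sup>2" for x y
  proof -
    \<comment> \<open>The image and residual differences add up to \<open>x - y\<close>, whose
      squared norm is expanded here.\<close>
    have expand: "2 * inner (T x - T y) ((x - T x) - (y - T y)) + (norm ((x - T x) - (y - T y)))\<^sup>2 =
        (norm (x - y))\<^sup>2 - (norm (T x - T y))\<^sup>2"
      unfolding power2_norm_eq_inner by (simp add: inner_diff inner_commute)
    have "norm (T x - T y) \<le> \<beta> * norm (x - y) \<longleftrightarrow> (norm (T x - T y))\<^sup>2 \<le> (\<beta> * norm (x - y))\<^sup>2"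
      using assms(1) by (simp add: power2_le_iff_abs_le)
    also have "\<dots> \<longleftrightarrow> (1 - \<beta>\<^sup>2) / \<beta>\<^sup>2 * (norm (T x - T y))\<^sup>2 \<le> (norm (x - y))\<^sup>2 - (norm (T x - T y))\<^sup>2"
      using assms(1) by (simp add: power_mult_distrib field_simps)
    finally show ?thesis unfolding expand .
  qed
  then show ?thesis
    using assms unfolding ball_gr_gr
    by (simp add: banach_contraction_def lipschitz_on_def dist_norm)
qed

lemma uniformly_monotone_iff:
  "(\<forall>x y. ereal (inner (T x - T y) ((x - T x) - (y - T y))) \<ge> enn2ereal (\<phi> (norm (T x - T y)))) \<longleftrightarrow>
     uniformly_monotone \<phi> A"
  unfolding uniformly_monotone_def ball_gr_gr ..

section \<open>Paramonotonicity, cyclic monotonicity and rectangularity\<close>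

lemma paramonotone_iff:
  "(\<forall>x y. (norm (T x - T y))\<^sup>2 = inner (x - y) (T x - T y) \<longrightarrow>
       T x = T (T x + y - T y) \<and> T y = T (T y + x - T x)) \<longleftrightarrow> paramonotone A"
  unfolding paramonotone_def ball_gr_gr inner_resid
  by (auto simp: gr_def mem_iff add_diff_eq)

text \<open>The two sums run over the same cycles up to a sign and an index shift: chains start at
  0, the points of the other definition at 1.\<close>

lemma cyclically_monotone_iff:
  "cyclically_firmly_nonexpansive T \<longleftrightarrow> cyclically_monotone A"
proof
  assume *: "cyclically_firmly_nonexpansive T"
  show "cyclically_monotone A"
    unfolding cyclically_monotone_def
  proof (intro allI impI)
    fix n and z :: "nat \<Rightarrow> 'a \<times> 'a" assume "range z \<subseteq> gr A"
    then have "snd (z i) \<in> A (fst (z i))" for i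
      using range_subsetD[of z "gr A" i] by (simp add: gr_def case_prod_unfold)
    then have T: "T (fst (z i) + snd (z i)) = fst (z i)" for i
      by (simp add: mem_iff)
    show "chain_sum n z (fst (z 0)) \<le> 0"
    proof (cases "n = 0")
      case False
      \<comment> \<open>Chain index \<open>i\<close> becomes point \<open>i + 1\<close>, and
        position \<open>n + 2\<close> repeats the first point to close a cycle of length
        \<open>Suc n\<close>, which is at least 2 since \<open>n\<close> is nonzero.\<close>
      define x where "x i = (if i = n + 2 then fst (z 0) + snd (z 0)
        else fst (z (i - 1)) + snd (z (i - 1)))" for i
      have "0 \<le> (\<Sum>i=1..Suc n. inner (x i - T (x i)) (T (x i) - T (x (i + 1))))"
        using * False unfolding cyclically_firmly_nonexpansive_def
        by (elim allE[of _ "Suc n"] impE allE[of _ x]) (auto simp: x_def)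
      also have "\<dots> = (\<Sum>i<n. inner (snd (z i)) (fst (z i) - fst (z (Suc i)))) +
          inner (snd (z n)) (fst (z n) - fst (z 0))"
        by (simp add: sum.atLeast1_atMost_eq x_def T)
      also have "\<dots> = - chain_sum n z (fst (z 0))"
        unfolding chain_sum_def
        by (simp add: inner_diff inner_commute sum_negf[symmetric])
      finally show ?thesis by simp
    qed (simp add: chain_sum_def)
  qed
next
  assume *: "cyclically_monotone A"
  show "cyclically_firmly_nonexpansive T"
    unfolding cyclically_firmly_nonexpansive_def
  proof (intro allI impI)
    fix n :: nat and x :: "nat \<Rightarrow> 'a" assume n: "2 \<le> n" and x: "x (n + 1) = x 1"
    obtain m where m: "n = Suc m" using n by (cases n) auto
    define z where "z i = (T (x (Suc i)), x (Suc i) - T (x (Suc i)))" for i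
    have "range z \<subseteq> gr A" by (auto simp: z_def gr_eq)
    then have "0 \<le> - chain_sum m z (fst (z 0))"
      using * by (simp add: cyclically_monotone_def)
    also have "\<dots> = (\<Sum>i=1..n. inner (x i - T (x i)) (T (x i) - T (x (i + 1))))"
      using x by (simp add: m chain_sum_def z_def sum.atLeast1_atMost_eq
          inner_diff inner_commute sum_negf[symmetric])
    finally show "0 \<le> (\<Sum>i=1..n. inner (x i - T (x i)) (T (x i) - T (x (i + 1))))" .
  qed
qed

lemma subdifferential_iff:
  "cyclically_firmly_nonexpansive T \<longleftrightarrow> (\<exists>f\<in>Gamma0. A = subdifferential f)"
proof
  assume "cyclically_firmly_nonexpansive T"
  moreover have "(T 0, 0 - T 0) \<in> gr A" unfolding gr_eq by (rule rangeI)
  ultimately show "\<exists>f\<in>Gamma0. A = subdifferential f"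
    unfolding cyclically_monotone_iff
    by (rule cyclically_monotone_imp_subdifferential[OF maximal])
next
  assume "\<exists>f\<in>Gamma0. A = subdifferential f"
  then show "cyclically_firmly_nonexpansive T"
    using cyclically_monotone_subdifferential unfolding cyclically_monotone_iff Gamma0_def by blast
qed

text \<open>The independent points \<open>x\<close> and \<open>y\<close> sweep out
  \<open>op_dom A\<close> through \<open>T\<close> and \<open>op_ran A\<close> through the
  residual.\<close>

lemma rectangular_iff:
  "(\<forall>x y. (INF z. ereal (inner (T x - T z) ((y - T y) - (z - T z)))) > -\<infinity>) \<longleftrightarrow> rectangular A"
  unfolding rectangular_def gr_eq range_eq_dom[symmetric] range_resid_eq_ran[symmetric]
  by (simp add: image_image)

section \<open>Linear and affine relations\<close>

text \<open>The graph is the image of the space under a linear map. Conversely, the components of a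
  graph point add up to an argument at which \<open>T\<close> returns the first one, so sums and
  multiples in the graph evaluate \<open>T\<close>.\<close>

lemma linear_iff: "linear T \<longleftrightarrow> subspace (gr A)"
proof
  assume "linear T"
  then have "linear (\<lambda>x. (T x, x - T x))"
    by (auto intro!: linearI simp: linear_add linear_scale algebra_simps)
  then show "subspace (gr A)"
    unfolding gr_eq by (intro linear_subspace_image subspace_UNIV)
next
  assume sub: "subspace (gr A)"
  show "linear T"
  proof (rule linearI)
    fix x y :: 'a and c :: real
    have mem: "(T x, x - T x) \<in> gr A" for x by (simp add: gr_eq)
    have "(T x, x - T x) + (T y, y - T y) \<in> gr A" "c *\<^sub>R (T x, x - T x) \<in> gr A"
      using subspace_add[OF sub mem mem] subspace_scale[OF sub mem] .
    then show "T (x + y) = T x + T y" "T (c *\<^sub>R x) = c *\<^sub>R T x"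
      by (auto simp: gr_def mem_iff algebra_simps)
  qed
qed

lemma affine_iff: "affine_map T \<longleftrightarrow> affine_relation A"
proof
  assume *: "affine_map T"
  have "(T (s *\<^sub>R x + t *\<^sub>R y), (s *\<^sub>R x + t *\<^sub>R y) - T (s *\<^sub>R x + t *\<^sub>R y)) =
      s *\<^sub>R (T x, x - T x) + t *\<^sub>R (T y, y - T y)" if "s + t = 1" for s t x y
  proof -
    have "t = 1 - s" using that by simp
    then have "T (s *\<^sub>R x + t *\<^sub>R y) = s *\<^sub>R T x + t *\<^sub>R T y"
      using * by (simp only: affine_map_def)
    then show ?thesis by (simp add: algebra_simps)
  qed
  then have "affine (gr A)"
    unfolding affine_def gr_eq by (auto simp: image_iff) (metis prod.inject)
  then show "affine_relation A" by (auto simp: affine_relation_def gr_eq)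
next
  assume "affine_relation A"
  then have aff: "affine (gr A)" by (simp add: affine_relation_def)
  show "affine_map T"
    unfolding affine_map_def
  proof (intro allI)
    fix x y and t :: real
    have "t *\<^sub>R (T x, x - T x) + (1 - t) *\<^sub>R (T y, y - T y) \<in> gr A"
      using aff by (intro mem_affine) (auto simp: gr_eq)
    then show "T (t *\<^sub>R x + (1 - t) *\<^sub>R y) = t *\<^sub>R T x + (1 - t) *\<^sub>R T y"
      by (auto simp: gr_def mem_iff algebra_simps)
  qed
qed

section \<open>Normal cones and projections\<close>

text \<open>That \<open>u\<close> is normal to \<open>C\<close> at \<open>p\<close> is the
  variational inequality for \<open>p\<close> as the point of \<open>C\<close> nearest to
  \<open>p + u\<close>.\<close>

lemma normal_cone_iff_nearest_point:
  assumes "C \<noteq> {}" "closed C" "convex C"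
  shows "A = subdifferential (iota C) \<longleftrightarrow> T = nearest_point C"
proof -
  have "A = subdifferential (iota C) \<longleftrightarrow>
      (\<forall>p u. T (p + u) = p \<longleftrightarrow> p \<in> C \<and> (\<forall>c\<in>C. inner (c - p) u \<le> 0))"
    unfolding fun_eq_iff set_eq_iff mem_iff subdifferential_iota[OF assms(1)] ..
  also have "\<dots> \<longleftrightarrow> (\<forall>p u. T (p + u) = p \<longleftrightarrow> nearest_point C (p + u) = p)"
    by (simp add: nearest_point_iff[OF assms(2,3,1)])
  also have "\<dots> \<longleftrightarrow> T = nearest_point C"
    unfolding fun_eq_iff by (metis add.commute diff_add_cancel)
  finally show ?thesis .
qed

text \<open>Zero is normal at each point of \<open>C\<close>, so \<open>T\<close> fixes
  \<open>C\<close>; every value of \<open>T\<close> lies in the domain of \<open>A\<close>, hence in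
  \<open>C\<close>.\<close>

lemma normal_cone_imp_range_Fix:
  assumes "C \<noteq> {}" "A = subdifferential (iota C)"
  shows "C = range T" "C = Fix T"
proof -
  have C: "p \<in> C" if "u \<in> A p" for p u
    using that by (simp add: assms(2) subdifferential_iota[OF assms(1)])
  have "T c = c" if "c \<in> C" for c
    using that mem_iff[of 0 c] by (simp add: assms(2) subdifferential_iota[OF assms(1)])
  then show "C = range T" "C = Fix T"
    using C[OF resid_mem] by (auto simp: Fix_def) (metis rangeI)+
qed

lemma range_eq_Fix_iff: "range T = Fix T \<longleftrightarrow> normal_cone_operator A"
proof
  assume eq: "range T = Fix T"
  have mon: "0 \<le> inner (T x - c) (x - T x)" if "c \<in> Fix T" for x c
    using inner_resid[of x c] firm_le[of x c] that by (auto simp: Fix_def)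
  have Fix: "Fix T = {c. \<forall>x. inner (x - T x) c \<le> inner (x - T x) (T x)}"
  proof (intro equalityI subsetI CollectI allI)
    fix c x assume "c \<in> Fix T"
    then show "inner (x - T x) c \<le> inner (x - T x) (T x)"
      using mon[of c x] by (simp add: inner_diff inner_commute)
  next
    fix c assume "c \<in> {c. \<forall>x. inner (x - T x) c \<le> inner (x - T x) (T x)}"
    \<comment> \<open>The half-space belonging to \<open>x = c\<close> already forces
      \<open>c\<close> to be fixed.\<close>
    then have "inner (c - T c) (c - T c) \<le> 0" by (simp add: inner_diff)
    then have "c - T c = 0" by (metis inner_gt_zero_iff not_less)
    then show "c \<in> Fix T" by (simp add: Fix_def)
  qed
  have half: "Fix T = (\<Inter>x. {c. inner (x - T x) c \<le> inner (x - T x) (T x)})"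
    unfolding Fix by auto
  have "Fix T \<noteq> {}" using eq by auto
  moreover have "closed (Fix T)" "convex (Fix T)"
    unfolding half by (auto intro!: closed_INT convex_INT simp: closed_halfspace_le convex_halfspace_le)
  moreover have "A = subdifferential (iota (Fix T))"
  proof (rule maximally_monotone_eqI[OF maximal monotone_subdifferential_iota[OF \<open>Fix T \<noteq> {}\<close>]])
    fix p
    show "A p \<subseteq> subdifferential (iota (Fix T)) p"
    proof
      fix u assume "u \<in> A p"
      then have p: "T (p + u) = p" by (simp add: mem_iff)
      have "inner (c - p) u \<le> 0" if "c \<in> Fix T" for c
        using mon[OF that, of "p + u"] p by (simp add: inner_diff)
      \<comment> \<open>As an image point, \<open>p\<close> is fixed by the assumed equality of
        range and fixed points.\<close>
      moreover have "p \<in> Fix T" using p eq by (metis rangeI)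
      ultimately show "u \<in> subdifferential (iota (Fix T)) p"
        using subdifferential_iota[OF \<open>Fix T \<noteq> {}\<close>] by blast
    qed
  qed
  ultimately show "normal_cone_operator A"
    unfolding normal_cone_operator_def by blast
next
  assume "normal_cone_operator A"
  then show "range T = Fix T"
    using normal_cone_imp_range_Fix unfolding normal_cone_operator_def by metis
qed

section \<open>Weak sequential continuity\<close>

text \<open>From continuity to closedness, one passes to the weak limit in the form
  \<open>T (p + u) = p\<close> of graph membership. The converse rests on weak compactness.\<close>

lemma weakly_continuous_iff:
  "sequentially_weakly_continuous T \<longleftrightarrow> sequentially_weakly_closed (gr A)"
proof
  assume cont: "sequentially_weakly_continuous T"
  show "sequentially_weakly_closed (gr A)"
    unfolding sequentially_weakly_closed_def
  proof (intro allI impI, elim conjE)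
    fix s and z :: "'a \<times> 'a" assume s: "\<forall>n. s n \<in> gr A" and lim: "weakly_converges s z"
    obtain x u where z: "z = (x, u)" by fastforce
    have x: "weakly_converges (\<lambda>n. fst (s n)) x" and u: "weakly_converges (\<lambda>n. snd (s n)) u"
      using lim unfolding z weakly_converges_Pair by auto
    have "T (fst (s n) + snd (s n)) = fst (s n)" for n
      using s[rule_format, of n] by (simp add: gr_def mem_iff case_prod_unfold)
    then have "weakly_converges (\<lambda>n. fst (s n)) (T (x + u))"
      using cont weakly_converges_add[OF x u] unfolding sequentially_weakly_continuous_def by fastforce
    then have "T (x + u) = x" using x by (rule weakly_converges_unique)
    then show "z \<in> gr A" by (simp add: z gr_def mem_iff)
  qed
next
  assume closed: "sequentially_weakly_closed (gr A)"
  show "sequentially_weakly_continuous T"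
    unfolding sequentially_weakly_continuous_def
  proof (intro allI impI)
    fix s and x :: 'a assume lim: "weakly_converges s x"
    have "bounded (range s)" using lim by (rule weakly_convergent_imp_bounded)
    then obtain B where B: "\<And>n. norm (s n) \<le> B" by (auto simp: bounded_iff)
    have Tb: "norm (T (s n)) \<le> B + norm (T 0)" for n
      using nonexpansive[of "s n" 0] B[of n] norm_triangle_ineq2[of "T (s n)" "T 0"] by simp
    show "weakly_converges (\<lambda>n. T (s n)) (T x)"
      unfolding weakly_converges_def
    \<comment> \<open>Failure of convergence gives a subsequence avoiding a neighbourhood of the
      expected limit; a weakly convergent further subsequence turns out to have that very
      limit.\<close>
    proof (intro allI, rule ccontr)
      fix w assume "\<not> (\<lambda>n. inner (T (s n)) w) \<longlonglongrightarrow> inner (T x) w"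
      then obtain S where S: "open S" "inner (T x) w \<in> S"
        "\<not> (\<forall>\<^sub>F n in sequentially. inner (T (s n)) w \<in> S)"
        unfolding tendsto_def by blast
      then obtain r :: "nat \<Rightarrow> nat" where r: "strict_mono r" "\<And>n. inner (T (s (r n))) w \<notin> S"
        using not_eventually_sequentiallyD by blast
      have "bounded (range (\<lambda>n. T (s (r n))))"
        using Tb by (auto simp: bounded_iff)
      then obtain q p where q: "strict_mono q" and p: "weakly_converges ((\<lambda>n. T (s (r n))) \<circ> q) p"
        using bounded_imp_weakly_convergent_subseq by blast
      define t where "t n = s (r (q n))" for n
      have Tt: "weakly_converges (\<lambda>n. T (t n)) p" using p by (simp add: t_def o_def)
      have "weakly_converges t x"
        using weakly_converges_subseq[OF lim strict_mono_o[OF r(1) q]]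
        unfolding comp_def t_def[symmetric] .
      \<comment> \<open>These pairs lie in the graph of \<open>A\<close>, so closedness puts their
        weak limit \<open>(p, x - p)\<close> there, which says \<open>T x = p\<close>.\<close>
      then have "weakly_converges (\<lambda>n. (T (t n), t n - T (t n))) (p, x - p)"
        using Tt by (simp add: weakly_converges_Pair weakly_converges_diff)
      moreover have "\<forall>n. (T (t n), t n - T (t n)) \<in> gr A"
        by (simp add: gr_eq)
      ultimately have "(p, x - p) \<in> gr A"
        using closed[unfolded sequentially_weakly_closed_def, rule_format,
            of "\<lambda>n. (T (t n), t n - T (t n))" "(p, x - p)"] by blast
      then have "T x = p" by (simp add: gr_def mem_iff)
      then have "(\<lambda>n. inner (T (t n)) w) \<longlonglongrightarrow> inner (T x) w"
        using Tt by (simp add: weakly_converges_def)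
      then have "\<forall>\<^sub>F n in sequentially. inner (T (t n)) w \<in> S"
        using S(1,2) by (rule topological_tendstoD)
      then show False using r(2) by (simp add: t_def)
    qed
  qed
qed

end

theorem theorem2p1:
  fixes T :: "'a::{real_inner, complete_space} \<Rightarrow> 'a"
    and A :: "'a \<Rightarrow> 'a set"
  assumes "firmly_nonexpansive T"
    and "maximally_monotone A"
  shows "(op_of T = resolvent A \<longleftrightarrow> A = op_minus (op_inv (op_of T)) (op_of id)) \<and>
    (op_of T = resolvent A \<longrightarrow>
      \<comment> \<open>(i)\<close>
      range T = op_dom A \<and>
      \<comment> \<open>(ii)\<close>
      (surj T \<longleftrightarrow> op_dom A = UNIV) \<and>
      \<comment> \<open>(iii)\<close>
      (surj (\<lambda>x. x - T x) \<longleftrightarrow> op_ran A = UNIV) \<and>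
      \<comment> \<open>(iv)\<close>
      (inj T \<longleftrightarrow> at_most_single_valued A) \<and>
      \<comment> \<open>(v)\<close>
      (((\<forall>x y. norm (T x - T y) = norm (x - y)) \<longleftrightarrow> (\<exists>z. \<forall>x. A x = {z})) \<and>
       (\<forall>z. (\<forall>x. A x = {z}) \<longrightarrow> (\<forall>x. T x = x - z))) \<and>
      \<comment> \<open>(vi)\<close>
      ((\<forall>x y. T x \<noteq> T y \<longrightarrow> (norm (T x - T y))\<^sup>2 < inner (x - y) (T x - T y)) \<longleftrightarrow>
         strictly_monotone A) \<and>
      \<comment> \<open>(vii)\<close>
      (strictly_monotone (op_of T) \<longleftrightarrow> at_most_single_valued A) \<and>
      \<comment> \<open>(viii)\<close>
      (strictly_firmly_nonexpansive T \<longleftrightarrow> at_most_single_valued A \<and> strictly_monotone A) \<and>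
      \<comment> \<open>(ix)\<close>
      (strictly_nonexpansive T \<longleftrightarrow> disjointly_injective A) \<and>
      \<comment> \<open>(x)\<close>
      ((inj T \<and> strictly_nonexpansive T \<longleftrightarrow>
          (\<forall>x y. x \<noteq> y \<longrightarrow> 0 < norm (T x - T y) \<and> norm (T x - T y) < norm (x - y))) \<and>
       (inj T \<and> strictly_nonexpansive T \<longleftrightarrow>
          at_most_single_valued A \<and> disjointly_injective A)) \<and>
      \<comment> \<open>(xi)\<close>
      (\<forall>\<epsilon>::real. \<epsilon> > 0 \<longrightarrow>
         (firmly_nonexpansive (\<lambda>x. (1 + \<epsilon>) *\<^sub>R T x) \<longleftrightarrow> strongly_monotone \<epsilon> A) \<and>
         (strongly_monotone \<epsilon> A \<longrightarrow> banach_contraction (inverse (1 + \<epsilon>)) T)) \<and>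
      \<comment> \<open>(xii)\<close>
      (\<forall>\<gamma>::real. \<gamma> > 0 \<longrightarrow>
         (firmly_nonexpansive (\<lambda>x. (1 + \<gamma>) *\<^sub>R (x - T x)) \<longleftrightarrow> cocoercive \<gamma> A)) \<and>
      \<comment> \<open>(xiii)\<close>
      (\<forall>\<beta>::real. 0 < \<beta> \<and> \<beta> < 1 \<longrightarrow>
         (banach_contraction \<beta> T \<longleftrightarrow>
           (\<forall>(x, u)\<in>gr A. \<forall>(y, v)\<in>gr A.
              (1 - \<beta>\<^sup>2) / \<beta>\<^sup>2 * (norm (x - y))\<^sup>2
                \<le> 2 * inner (x - y) (u - v) + (norm (u - v))\<^sup>2))) \<and>
      \<comment> \<open>(xiv)\<close>
      (\<forall>\<phi> :: real \<Rightarrow> ennreal. mono_on {0..} \<phi> \<and> (\<forall>t\<ge>0. \<phi> t = 0 \<longleftrightarrow> t = 0) \<longrightarrow>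
         ((\<forall>x y. ereal (inner (T x - T y) ((x - T x) - (y - T y)))
                   \<ge> enn2ereal (\<phi> (norm (T x - T y)))) \<longleftrightarrow>
            uniformly_monotone \<phi> A)) \<and>
      \<comment> \<open>(xv)\<close>
      ((\<forall>x y. (norm (T x - T y))\<^sup>2 = inner (x - y) (T x - T y) \<longrightarrow>
                T x = T (T x + y - T y) \<and> T y = T (T y + x - T x)) \<longleftrightarrow>
         paramonotone A) \<and>
      \<comment> \<open>(xvi)\<close>
      (cyclically_firmly_nonexpansive T \<longleftrightarrow> (\<exists>f\<in>Gamma0. A = subdifferential f)) \<and>
      \<comment> \<open>(xvii)\<close>
      ((\<forall>x y. (INF z. ereal (inner (T x - T z) ((y - T y) - (z - T z)))) > -\<infinity>) \<longleftrightarrow>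
         rectangular A) \<and>
      \<comment> \<open>(xviii)\<close>
      (linear T \<longleftrightarrow> subspace (gr A)) \<and>
      \<comment> \<open>(xix)\<close>
      (affine_map T \<longleftrightarrow> affine_relation A) \<and>
      \<comment> \<open>(xx)\<close>
      ((range T = Fix T \<longleftrightarrow> normal_cone_operator A) \<and>
       (normal_cone_operator A \<longleftrightarrow>
          (\<exists>C. C \<noteq> {} \<and> closed C \<and> convex C \<and> T = nearest_point C)) \<and>
       (\<forall>C. C \<noteq> {} \<and> closed C \<and> convex C \<longrightarrow>
          (A = subdifferential (iota C) \<longleftrightarrow> T = nearest_point C) \<and>
          (A = subdifferential (iota C) \<longrightarrow> C = range T \<and> C = Fix T))) \<and>
      \<comment> \<open>(xxi)\<close>
      (sequentially_weakly_continuous T \<longleftrightarrow> sequentially_weakly_closed (gr A)))"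
proof (intro conjI[OF _ impI], goal_cases)
  case 1
  show ?case unfolding op_of_eq_resolvent_iff eq_inverse_minus_id_iff ..
next
  case 2
  then interpret resolvent_pair T A
    using assms by unfold_locales
  have surj: "surj T \<longleftrightarrow> op_dom A = UNIV"
    by (simp only: range_eq_dom)
  have surj_resid: "surj (\<lambda>x. x - T x) \<longleftrightarrow> op_ran A = UNIV"
    by (simp only: range_resid_eq_ran)
  have translation: "\<forall>z. (\<forall>x. A x = {z}) \<longrightarrow> (\<forall>x. T x = x - z)"
    using eq_translation by blast
  have injective: "inj T \<and> strictly_nonexpansive T \<longleftrightarrow>
      at_most_single_valued A \<and> disjointly_injective A"
    using inj_iff strictly_nonexpansive_iff by simp
  have strongly: "\<forall>\<epsilon>::real. \<epsilon> > 0 \<longrightarrow>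
      (firmly_nonexpansive (\<lambda>x. (1 + \<epsilon>) *\<^sub>R T x) \<longleftrightarrow> strongly_monotone \<epsilon> A) \<and>
      (strongly_monotone \<epsilon> A \<longrightarrow> banach_contraction (inverse (1 + \<epsilon>)) T)"
    using strongly_monotone_imp_contraction
    by (simp add: firmly_nonexpansive_scaleR_iff strongly_monotone_iff)
  have cocoercive: "\<forall>\<gamma>::real. \<gamma> > 0 \<longrightarrow>
      (firmly_nonexpansive (\<lambda>x. (1 + \<gamma>) *\<^sub>R (x - T x)) \<longleftrightarrow> cocoercive \<gamma> A)"
    using cocoercive_iff by blast
  have contraction: "\<forall>\<beta>::real. 0 < \<beta> \<and> \<beta> < 1 \<longrightarrow>
      (banach_contraction \<beta> T \<longleftrightarrow>
        (\<forall>(x, u)\<in>gr A. \<forall>(y, v)\<in>gr A.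
           (1 - \<beta>\<^sup>2) / \<beta>\<^sup>2 * (norm (x - y))\<^sup>2
             \<le> 2 * inner (x - y) (u - v) + (norm (u - v))\<^sup>2))"
    by (intro allI impI contraction_iff) simp_all
  have uniformly: "\<forall>\<phi> :: real \<Rightarrow> ennreal. mono_on {0..} \<phi> \<and> (\<forall>t\<ge>0. \<phi> t = 0 \<longleftrightarrow> t = 0) \<longrightarrow>
      ((\<forall>x y. ereal (inner (T x - T y) ((x - T x) - (y - T y)))
                \<ge> enn2ereal (\<phi> (norm (T x - T y)))) \<longleftrightarrow> uniformly_monotone \<phi> A)"
    by (intro allI impI uniformly_monotone_iff)
  have nearest: "normal_cone_operator A \<longleftrightarrow>
      (\<exists>C. C \<noteq> {} \<and> closed C \<and> convex C \<and> T = nearest_point C)"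
    using normal_cone_iff_nearest_point unfolding normal_cone_operator_def by blast
  have normal_cone: "\<forall>C. C \<noteq> {} \<and> closed C \<and> convex C \<longrightarrow>
      (A = subdifferential (iota C) \<longleftrightarrow> T = nearest_point C) \<and>
      (A = subdifferential (iota C) \<longrightarrow> C = range T \<and> C = Fix T)"
    by (intro allI impI conjI; elim conjE;
        erule normal_cone_iff_nearest_point normal_cone_imp_range_Fix; assumption)
  show ?case
    by (intro conjI range_eq_dom surj surj_resid inj_iff isometry_iff translation
        strictly_monotone_iff strictly_monotone_op_of_iff strictly_firmly_nonexpansive_iff
        strictly_nonexpansive_iff inj_strictly_nonexpansive_iff injective strongly cocoercive
        contraction uniformly paramonotone_iff subdifferential_iff rectangular_iff linear_iff
        affine_iff range_eq_Fix_iff nearest normal_cone weakly_continuous_iff)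
qed

end
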